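(* Let $\lambda>0$, $m\in\{0,1,2,\ldots\}$, and let $Z_\lambda\sim\mathcal{N}(0,\lambda)$. Then for all $F\in\mathcal{C}_c^\infty$, $$E\,H_\lambda^m(Z_\lambda)F(Z_\lambda)=\lambda^m\,E\,F^{(m)}(Z_\lambda),$$ and hence $(Z_\lambda)_\lambda^{(m)}=Z_\lambda$ in distribution; that is, for each $m$ the normal distribution $\mathcal{N}(0,\lambda)$ is a fixed point of the $m$-th order transformation induced by the Hermite polynomial $H_\lambda^m$.
   Context: $\mathcal{N}(0,\lambda)$ is the normal distribution with mean $0$ and variance $\lambda$. The Hermite polynomials are defined by $$e^{xt-\frac12\lambda t^2}=\sum_{m=0}^\infty H_\lambda^m(x)\frac{t^m}{m!},\quad\text{equivalently}\quad H_\lambda^m(x)=(-\lambda)^me^{\frac{x^2}{2\lambda}}\frac{d^m}{dx^m}e^{-\frac{x^2}{2\lambda}}.$$ $\mathcal{C}_c^\infty$ is the set of infinitely differentiable compactly supported functions on $\mathbf{R}$. For $X$ whose moments up to order $2m$ agree with those of $Z_\lambda$, $X_\lambda^{(m)}$ denotes a variable with the $X$-$H_\lambda^m$ biased distribution, the unique distribution characterized by $E\,H_\lambda^m(X)F(X)=\alpha\,E\,F^{(m)}(X_\lambda^{(m)})$ with $\alpha=\frac1{m!}E[X^mH_\lambda^m(X)]$; it is determined by this equality for all $F\in\mathcal{C}_c^\infty$. *)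

theory Defs
  imports "HOL-Probability.Probability"
begin

definition Cc_infinity :: "(real \<Rightarrow> real) set" where
  "Cc_infinity = {F. (\<forall>n x. (deriv ^^ n) F differentiable (at x)) \<and>
                     compact (closure {x. F x \<noteq> 0})}"

(* Rodrigues' formula; meaningful for l \<noteq> 0, used only for l > 0. *)
definition hermite :: "real \<Rightarrow> nat \<Rightarrow> real \<Rightarrow> real" where
  "hermite l m x =
     (- l) ^ m * exp (x\<^sup>2 / (2 * l)) * (deriv ^^ m) (\<lambda>y. exp (- (y\<^sup>2 / (2 * l)))) x"

(* The normal law is parametrised by its variance l, whereas normal_density
   takes the standard deviation. *)
definition normal_law :: "real \<Rightarrow> real measure" where
  "normal_law l = density lborel (normal_density 0 (sqrt l))"

definition normal_moments_upto :: "real \<Rightarrow> nat \<Rightarrow> real measure \<Rightarrow> bool" where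
  "normal_moments_upto l n P \<longleftrightarrow>
     (\<forall>k\<le>n. integrable P (\<lambda>x. x ^ k) \<and> (LINT x|P. x ^ k) = (LINT x|normal_law l. x ^ k))"

definition hermite_alpha :: "real \<Rightarrow> nat \<Rightarrow> real measure \<Rightarrow> real" where
  "hermite_alpha l m P = (LINT x|P. x ^ m * hermite l m x) / fact m"

(* Q is an X-H biased distribution, where P is the law of X.  The relation
   includes the conditions on P under which the transformation is defined. *)
definition is_hermite_biased :: "real \<Rightarrow> nat \<Rightarrow> real measure \<Rightarrow> real measure \<Rightarrow> bool" where
  "is_hermite_biased l m P Q \<longleftrightarrow>
     real_distribution P \<and> normal_moments_upto l (2 * m) P \<and> real_distribution Q \<and>
     (\<forall>F\<in>Cc_infinity.
        (LINT x|P. hermite l m x * F x) = hermite_alpha l m P * (LINT x|Q. (deriv ^^ m) F x))"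

(* Unspecified where existence or uniqueness fails. *)
definition hermite_transform :: "real \<Rightarrow> nat \<Rightarrow> real measure \<Rightarrow> real measure" where
  "hermite_transform l m P = (THE Q. is_hermite_biased l m P Q)"

end

theory Submission
  imports Defs
begin

text \<open>
  The moment identity is an iterated integration by parts.  Stein's identity
  \<open>E[Z * G(Z)] = l * E[G'(Z)]\<close> (\<open>stein_identity\<close>) holds for functions of polynomial growth, and the
  recursion \<open>H\<^sub>m\<^sub>+\<^sub>1 = x * H\<^sub>m - l * H\<^sub>m'\<close> rewrites it as \<open>E[H\<^sub>m\<^sub>+\<^sub>1(Z) * F(Z)] = l * E[H\<^sub>m(Z) * F'(Z)]\<close>.
  Induction on \<open>m\<close> gives \<open>E[H\<^sub>m(Z) * F(Z)] = l ^ m * E[F\<^sup>(\<^sup>m\<^sup>)(Z)]\<close>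
  (\<open>hermite_integration_by_parts\<close>).  Applied to \<open>F(x) = x ^ m\<close> it also shows that the normalising
  constant of the transformation equals \<open>l ^ m\<close>, so the normal law is biased relative to itself.

  For uniqueness, suppose that \<open>Q\<close> is a biased distribution of the normal law \<open>N\<close>.  As
  \<open>l ^ m\<close> is not zero, \<open>Q\<close> and \<open>N\<close> assign the same integral to the \<open>m\<close>-th derivative of every test
  function.  The order of the derivative can be lowered step by step
  (\<open>funpow_deriv_integral_determines\<close>): integrating a test function \<open>F\<close> over a sliding window of
  length \<open>T\<close> gives a test function with derivative \<open>F(x) - F(x - T)\<close>, and the translated term
  disappears in the limit of large \<open>T\<close> because it is bounded and tends to zero pointwise.  At
  order zero, \<open>Q\<close> and \<open>N\<close> agree on all test functions; these include smooth approximations of the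
  indicators of half-lines (\<open>plateau_tendsto\<close>), so \<open>Q = N\<close> (\<open>Cc_infinity_integral_determines\<close>).
\<close>

section \<open>Smooth functions on the line\<close>

definition smooth :: "(real \<Rightarrow> real) \<Rightarrow> bool" where
  "smooth F \<longleftrightarrow> (\<forall>n x. (deriv ^^ n) F differentiable (at x))"

lemma smooth_has_deriv:
  assumes "smooth F"
  shows "((deriv ^^ n) F has_real_derivative (deriv ^^ Suc n) F x) (at x)"
  using assms unfolding smooth_def by (simp add: DERIV_deriv_iff_real_differentiable)

lemma smooth_has_deriv_1:
  "smooth F \<Longrightarrow> (F has_real_derivative deriv F x) (at x)"
  using smooth_has_deriv[of F 0] by simp

lemma smooth_funpow_deriv: "smooth F \<Longrightarrow> smooth ((deriv ^^ k) F)"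
  unfolding smooth_def funpow_add[symmetric, THEN fun_cong, unfolded comp_def] by auto

lemma smooth_deriv: "smooth F \<Longrightarrow> smooth (deriv F)"
  using smooth_funpow_deriv[of F 1] by simp

lemma smooth_imp_isCont: "smooth F \<Longrightarrow> isCont F x"
  using smooth_has_deriv_1 DERIV_isCont by blast

lemma borel_measurable_smooth: "smooth F \<Longrightarrow> F \<in> borel_measurable borel"
  by (intro borel_measurable_continuous_onI continuous_at_imp_continuous_on ballI smooth_imp_isCont)

text \<open>
  Smoothness is a greatest fixed point: a set of differentiable functions that is closed under
  taking derivatives consists of smooth functions.  The closure properties below, and the
  smoothness of \<open>exp_flat\<close>, each amount to naming such a set, with no formula for
  higher derivatives.
\<close>

lemma smooth_coinduct:
  assumes "F \<in> S"
    and step: "\<And>G. G \<in> S \<Longrightarrow> \<exists>G'\<in>S. \<forall>x. (G has_real_derivative G' x) (at x)"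
  shows "smooth F"
proof -
  have *: "deriv G \<in> S \<and> (\<forall>x. (G has_real_derivative deriv G x) (at x))" if "G \<in> S" for G
  proof -
    from step[OF that] obtain G' where G': "G' \<in> S" "\<forall>x. (G has_real_derivative G' x) (at x)"
      by blast
    then have "deriv G = G'"
      by (auto intro!: DERIV_imp_deriv)
    with G' show ?thesis by simp
  qed
  have "(deriv ^^ n) F \<in> S" for n
    by (induction n) (use assms(1) * in auto)
  then show ?thesis
    unfolding smooth_def using * real_differentiable_def by blast
qed

lemma smooth_affine:
  assumes "smooth F"
  shows "smooth (\<lambda>x. F (a * x + b))"
proof (rule smooth_coinduct)
  let ?S = "{(\<lambda>x. c * G (a * x + b)) | c G. smooth G}"
  have "(\<lambda>x. F (a * x + b)) = (\<lambda>x. 1 * F (a * x + b))" by simp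
  then show "(\<lambda>x. F (a * x + b)) \<in> ?S" using assms by blast
  fix H assume "H \<in> ?S"
  then obtain c G where H: "H = (\<lambda>x. c * G (a * x + b))" "smooth G" by blast
  have "(H has_real_derivative (c * a) * deriv G (a * x + b)) (at x)" for x
    unfolding H(1)
    by (rule derivative_eq_intros refl DERIV_chain2[OF smooth_has_deriv_1[OF H(2)]] | simp)+
  then show "\<exists>G'\<in>?S. \<forall>x. (H has_real_derivative G' x) (at x)"
    using smooth_deriv[OF H(2)] by (intro bexI[of _ "\<lambda>x. (c * a) * deriv G (a * x + b)"]) auto
qed

text \<open>
  The derivative of a product is a sum of two products, so it is the finite sums of products that
  form a set closed under differentiation.
\<close>

inductive_set product_sums :: "(real \<Rightarrow> real) set" where
  mult: "smooth F \<Longrightarrow> smooth G \<Longrightarrow> (\<lambda>x. F x * G x) \<in> product_sums"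
| add: "A \<in> product_sums \<Longrightarrow> B \<in> product_sums \<Longrightarrow> (\<lambda>x. A x + B x) \<in> product_sums"

lemma smooth_mult:
  assumes "smooth F" "smooth G"
  shows "smooth (\<lambda>x. F x * G x)"
proof (rule smooth_coinduct)
  show "(\<lambda>x. F x * G x) \<in> product_sums" using assms by (rule product_sums.mult)
  fix H assume "H \<in> product_sums"
  then show "\<exists>H'\<in>product_sums. \<forall>x. (H has_real_derivative H' x) (at x)"
  proof induction
    case (mult F G)
    have "(\<lambda>x. deriv F x * G x + F x * deriv G x) \<in> product_sums"
      using mult smooth_deriv by (intro product_sums.intros) auto
    moreover have "((\<lambda>x. F x * G x) has_real_derivative
        deriv F x * G x + F x * deriv G x) (at x)" for x
      using DERIV_mult[OF smooth_has_deriv_1[OF mult(1), of x] smooth_has_deriv_1[OF mult(2), of x]]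
      by (simp add: algebra_simps)
    ultimately show ?case by (intro bexI) auto
  next
    case (add A B)
    then obtain A' B' where "A' \<in> product_sums" "\<forall>x. (A has_real_derivative A' x) (at x)"
      "B' \<in> product_sums" "\<forall>x. (B has_real_derivative B' x) (at x)" by blast
    then show ?case
      by (intro bexI[of _ "\<lambda>x. A' x + B' x"] allI DERIV_add product_sums.add) auto
  qed
qed

lemma funpow_deriv_eqI:
  fixes D :: "nat \<Rightarrow> real \<Rightarrow> real"
  assumes "\<And>n x. (D n has_real_derivative D (Suc n) x) (at x)"
  shows "(deriv ^^ n) (D 0) = D n"
proof (induction n)
  case (Suc n)
  have "deriv (D n) = D (Suc n)" using assms by (auto intro!: DERIV_imp_deriv)
  with Suc show ?case by simp
qed simp

section \<open>Test functions\<close>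

lemma Cc_infinity_iff:
  "F \<in> Cc_infinity \<longleftrightarrow> smooth F \<and> (\<exists>R. \<forall>x. R < \<bar>x\<bar> \<longrightarrow> F x = 0)"
proof -
  have "compact (closure {x. F x \<noteq> 0}) \<longleftrightarrow> (\<exists>R. \<forall>x. R < \<bar>x\<bar> \<longrightarrow> F x = 0)"
    unfolding compact_closure bounded_iff by (auto simp: not_less) (meson not_less)+
  then show ?thesis unfolding Cc_infinity_def smooth_def by blast
qed

lemma Cc_infinity_funpow_deriv:
  assumes "F \<in> Cc_infinity"
  shows "(deriv ^^ n) F \<in> Cc_infinity"
proof (induction n)
  case (Suc n)
  let ?G = "(deriv ^^ n) F"
  from Suc obtain R where G: "smooth ?G" and R: "\<And>x. R < \<bar>x\<bar> \<Longrightarrow> ?G x = 0"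
    unfolding Cc_infinity_iff by blast
  have "deriv ?G x = 0" if "R < \<bar>x\<bar>" for x
  proof -
    have "open {x::real. R < \<bar>x\<bar>}" by (intro open_Collect_less continuous_intros)
    then have "(?G has_real_derivative 0) (at x)"
      by (rule has_field_derivative_transform_within_open[where f = "\<lambda>_. 0", rotated])
         (use that R in auto)
    then show ?thesis by (rule DERIV_imp_deriv)
  qed
  then show ?case using smooth_deriv[OF G] by (auto simp: Cc_infinity_iff)
qed (use assms in simp)

lemma Cc_infinity_bounded:
  assumes "F \<in> Cc_infinity"
  obtains B where "\<And>x. \<bar>F x\<bar> \<le> B"
proof -
  from assms obtain R where F: "smooth F" and R: "\<And>x. R < \<bar>x\<bar> \<Longrightarrow> F x = 0"
    unfolding Cc_infinity_iff by blast
  have "bounded (F ` {-R..R})"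
    by (intro compact_imp_bounded compact_continuous_image continuous_at_imp_continuous_on ballI
          smooth_imp_isCont[OF F] compact_Icc)
  then obtain B where "\<forall>y\<in>F ` {-R..R}. \<bar>y\<bar> \<le> B"
    unfolding bounded_iff real_norm_def by blast
  then have B: "\<bar>F x\<bar> \<le> B" if "x \<in> {-R..R}" for x
    using that by blast
  have "\<bar>F x\<bar> \<le> max B 0" for x
    using B[of x] R[of x] by (cases "R < \<bar>x\<bar>") (fastforce simp: le_max_iff_disj)+
  then show ?thesis by (rule that)
qed

section \<open>Smooth approximations of half-lines\<close>

text \<open>
  The classical smooth function that vanishes on the left half-line and is positive on the right one,
  with a polynomial in \<open>1 / x\<close> as an additional factor: this factor makes the family closed under
  differentiation.
\<close>

definition exp_flat :: "real poly \<Rightarrow> real \<Rightarrow> real" where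
  "exp_flat p x = (if x > 0 then poly p (inverse x) * exp (- inverse x) else 0)"

lemma poly_times_exp_tendsto_0: "((\<lambda>y. poly p y * exp (- y)) \<longlongrightarrow> (0::real)) at_top"
proof -
  have "((\<lambda>y. \<Sum>i\<le>degree p. coeff p i * (y ^ i / exp y)) \<longlongrightarrow> (\<Sum>i\<le>degree p. coeff p i * 0)) at_top"
    by (intro tendsto_intros tendsto_power_div_exp_0)
  then show ?thesis
    by (simp add: poly_altdef sum_distrib_right exp_minus divide_inverse mult.assoc)
qed

lemma exp_flat_has_deriv:
  "(exp_flat p has_real_derivative exp_flat ([:0, 0, 1:] * (p - pderiv p)) x) (at x)"
proof -
  consider "x > 0" | "x < 0" | "x = 0" by linarith
  then show ?thesis
  proof cases
    case 1
    have "((\<lambda>x. poly p (inverse x) * exp (- inverse x)) has_real_derivative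
        exp_flat ([:0, 0, 1:] * (p - pderiv p)) x) (at x)"
      unfolding exp_flat_def
      by (rule derivative_eq_intros refl | use 1 in \<open>force simp: field_simps power2_eq_square\<close>)+
    moreover have "eventually (\<lambda>y. y \<in> {0<..}) (nhds x)"
      using 1 by (intro eventually_nhds_in_open) auto
    then have "eventually (\<lambda>y. exp_flat p y = poly p (inverse y) * exp (- inverse y)) (nhds x)"
      by eventually_elim (simp add: exp_flat_def)
    ultimately show ?thesis by (subst DERIV_cong_ev[OF refl _ refl])
  next
    case 2
    have "eventually (\<lambda>y. y \<in> {..<0}) (nhds x)"
      using 2 by (intro eventually_nhds_in_open) auto
    then have "eventually (\<lambda>y. exp_flat p y = 0) (nhds x)"
      by eventually_elim (simp add: exp_flat_def)
    then show ?thesis using 2 by (subst DERIV_cong_ev[OF refl _ refl]) (auto simp: exp_flat_def)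
  next
    case 3
    have "((\<lambda>h. exp_flat p h / h) \<longlongrightarrow> 0) (at_right 0)"
    proof -
      have "((\<lambda>h. poly ([:0, 1:] * p) (inverse h) * exp (- inverse h)) \<longlongrightarrow> (0::real)) (at_right 0)"
        by (rule filterlim_compose[OF poly_times_exp_tendsto_0 filterlim_inverse_at_top_right])
      then show ?thesis
        by (rule Lim_transform_eventually)
           (auto simp: exp_flat_def eventually_at_filter field_simps intro!: always_eventually)
    qed
    moreover have "((\<lambda>h. exp_flat p h / h) \<longlongrightarrow> 0) (at_left 0)"
      by (rule tendsto_eventually) (auto simp: exp_flat_def eventually_at_filter)
    ultimately have "((\<lambda>h. exp_flat p h / h) \<longlongrightarrow> 0) (at 0)"
      using filterlim_split_at by blast
    then show ?thesis using 3 by (simp add: DERIV_def exp_flat_def)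
  qed
qed

lemma smooth_exp_flat: "smooth (exp_flat p)"
  by (rule smooth_coinduct[of _ "range exp_flat"]) (use exp_flat_has_deriv in blast)+

text \<open>
  Since \<open>exp_flat 1\<close> increases to 1 at infinity, rescaling it by \<open>n\<close> gives a smooth step at \<open>a\<close>.  The
  second factor is a descending step at \<open>n\<close>, which moves away and provides compact support.
  The affine arguments stand for \<open>n * (x - a)\<close> and \<open>n * (n - x)\<close>.
\<close>

definition plateau :: "real \<Rightarrow> nat \<Rightarrow> real \<Rightarrow> real" where
  "plateau a n x = exp_flat 1 (real n * x + (- real n * a)) * exp_flat 1 ((- real n) * x + real n * real n)"

lemma plateau_Cc_infinity: "plateau a n \<in> Cc_infinity"
proof -
  have "smooth (plateau a n)"
    unfolding plateau_def[abs_def] by (intro smooth_mult smooth_affine smooth_exp_flat)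
  moreover have "plateau a n x = 0" if "\<bar>a\<bar> + real n < \<bar>x\<bar>" for x
  proof -
    have "x \<le> a \<or> real n \<le> x" using that by linarith
    then have "real n * x \<le> real n * a \<or> real n * real n \<le> real n * x"
      by (auto intro: mult_left_mono)
    then show ?thesis by (auto simp: plateau_def exp_flat_def)
  qed
  ultimately show ?thesis unfolding Cc_infinity_iff by blast
qed

lemma exp_flat_1_range: "\<bar>exp_flat 1 x\<bar> \<le> 1"
  by (simp add: exp_flat_def)

lemma plateau_bounded: "\<bar>plateau a n x\<bar> \<le> 1"
  unfolding plateau_def abs_mult by (intro mult_le_one exp_flat_1_range) auto

lemma exp_flat_1_at_top: "(exp_flat 1 \<longlongrightarrow> 1) at_top"
proof -
  have "((\<lambda>x::real. exp (- inverse x)) \<longlongrightarrow> exp (- 0)) at_top"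
    by (intro tendsto_intros tendsto_inverse_0_at_top filterlim_ident)
  then have "((\<lambda>x::real. exp (- inverse x)) \<longlongrightarrow> 1) at_top" by simp
  then show ?thesis
    by (rule Lim_transform_eventually)
       (use eventually_gt_at_top[of 0] in eventually_elim, simp add: exp_flat_def)
qed

lemma plateau_tendsto: "(\<lambda>n. plateau a n x) \<longlonglongrightarrow> indicator {a<..} x"
proof (cases "a < x")
  case True
  have 1: "filterlim (\<lambda>n. real n * (x - a)) at_top sequentially"
    using True by (intro filterlim_at_top_mult_tendsto_pos[OF tendsto_const _ filterlim_real_sequentially]) simp
  have 2: "filterlim (\<lambda>n. (real n - x) * real n) at_top sequentially"
    using filterlim_tendsto_add_at_top[OF tendsto_const[of "- x"] filterlim_real_sequentially]
    by (intro filterlim_at_top_mult_at_top filterlim_real_sequentially) simp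
  have "(\<lambda>n. exp_flat 1 (real n * (x - a)) * exp_flat 1 ((real n - x) * real n)) \<longlonglongrightarrow> 1 * 1"
    by (intro tendsto_mult filterlim_compose[OF exp_flat_1_at_top] 1 2)
  with True show ?thesis by (simp add: plateau_def[abs_def] algebra_simps)
next
  case False
  then have le: "real n * x \<le> real n * a" for n by (intro mult_left_mono) auto
  have "plateau a n x = 0" for n using le[of n] by (simp add: plateau_def exp_flat_def)
  with False show ?thesis by simp
qed

section \<open>Distributions determined by derivatives of test functions\<close>

lemma Cc_infinity_integral_determines:
  assumes "real_distribution P" "real_distribution Q"
    and eq: "\<And>F. F \<in> Cc_infinity \<Longrightarrow> (LINT x|P. F x) = (LINT x|Q. F x)"
  shows "P = Q"
proof -
  interpret P: real_distribution P by fact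
  interpret Q: real_distribution Q by fact
  have lim: "(\<lambda>n. LINT x|R. plateau a n x) \<longlonglongrightarrow> measure R {a<..}"
    if "real_distribution R" for R a
  proof -
    interpret R: real_distribution R by fact
    have [measurable]: "plateau a n \<in> borel_measurable borel" for n
      using plateau_Cc_infinity[of a n] unfolding Cc_infinity_iff
      by (intro borel_measurable_smooth) (rule conjunct1)
    have "(\<lambda>n. LINT x|R. plateau a n x) \<longlonglongrightarrow> (LINT x|R. indicator {a<..} x)"
      by (rule integral_dominated_convergence[where w = "\<lambda>_. 1"])
         (auto intro!: plateau_tendsto plateau_bounded always_eventually)
    then show ?thesis by simp
  qed
  have "measure P {a<..} = measure Q {a<..}" for a
    using lim[OF assms(1), of a] lim[OF assms(2), of a] eq[OF plateau_Cc_infinity]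
    by (auto intro: LIMSEQ_unique)
  then show ?thesis
    by (intro measure_eqI_lessThan)
       (auto simp: P.emeasure_eq_measure Q.emeasure_eq_measure less_top[symmetric])
qed

text \<open>
  With \<open>A\<close> an antiderivative of \<open>F\<close>, the function \<open>G x = A x - A (x - T)\<close> integrates \<open>F\<close> over a
  window of length \<open>T\<close>, and so vanishes as soon as the window misses the support of \<open>F\<close>.  An
  antiderivative of \<open>F\<close> itself has compact support only if \<open>F\<close> has integral zero; subtracting
  a translate repairs this at the price of an error that can be pushed off to infinity.
\<close>

lemma Cc_infinity_shifted_difference:
  assumes F: "F \<in> Cc_infinity" and "T > 0"
  obtains G where "G \<in> Cc_infinity" "\<And>n x. (deriv ^^ Suc n) G x = (deriv ^^ n) F x - (deriv ^^ n) F (x - T)"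
proof -
  from F obtain R where sm: "smooth F" and R: "\<And>x. R < \<bar>x\<bar> \<Longrightarrow> F x = 0"
    unfolding Cc_infinity_iff by blast
  obtain A where A: "\<And>x. (A has_real_derivative F x) (at x)"
    using einterval_antiderivative[of "-\<infinity>" "\<infinity>" F] smooth_imp_isCont[OF sm]
    by (auto simp: has_real_derivative_iff_has_vector_derivative)
  define G where "G = (\<lambda>x. A x - A (x - T))"
  define D where "D = (\<lambda>n. case n of 0 \<Rightarrow> G | Suc k \<Rightarrow> (\<lambda>x. (deriv ^^ k) F x - (deriv ^^ k) F (x - T)))"
  have shift: "((\<lambda>x. H (x - T)) has_real_derivative H' (x - T)) (at x)"
    if "\<And>x. (H has_real_derivative H' x) (at x)" for H H' x
    using DERIV_shift[of H "H' (x - T)" x "- T"] that by simp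
  have D: "(D n has_real_derivative D (Suc n) x) (at x)" for n x
    using A smooth_has_deriv[OF sm]
    by (cases n) (auto simp: D_def G_def simp del: funpow.simps intro!: DERIV_diff shift)
  have Dn: "(deriv ^^ n) G = D n" for n
    using funpow_deriv_eqI[of D n, OF D] by (simp add: D_def)
  have "smooth G"
    unfolding smooth_def Dn using D real_differentiable_def by blast
  moreover have "G x = 0" if "R + T < \<bar>x\<bar>" for x
  proof -
    obtain z where z: "x - T < z" "z < x" "A x - A (x - T) = (x - (x - T)) * F z"
      using MVT2[of "x - T" x A F] A \<open>T > 0\<close> by auto
    moreover have "R < \<bar>z\<bar>" using that z(1,2) by linarith
    ultimately show ?thesis by (simp add: G_def R)
  qed
  ultimately have "G \<in> Cc_infinity" unfolding Cc_infinity_iff by blast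
  moreover have "(deriv ^^ Suc n) G x = (deriv ^^ n) F x - (deriv ^^ n) F (x - T)" for n x
    unfolding Dn by (simp add: D_def)
  ultimately show ?thesis by (rule that)
qed

lemma shift_integral_tendsto_0:
  assumes "real_distribution R" and F: "F \<in> Cc_infinity"
  shows "(\<lambda>n. LINT x|R. F (x - real n)) \<longlonglongrightarrow> 0"
    and "integrable R (\<lambda>x. F (x - c))"
proof -
  interpret R: real_distribution R by fact
  obtain B where B: "\<And>x. \<bar>F x\<bar> \<le> B" using Cc_infinity_bounded[OF F] by blast
  obtain r where sm: "smooth F" and r: "\<And>x. r < \<bar>x\<bar> \<Longrightarrow> F x = 0"
    using F unfolding Cc_infinity_iff by blast
  have [measurable]: "F \<in> borel_measurable borel"
    by (rule borel_measurable_smooth[OF sm])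
  have lim: "(\<lambda>n. F (x - real n)) \<longlonglongrightarrow> 0" for x
  proof (rule tendsto_eventually)
    have "eventually (\<lambda>n. x + r < real n) sequentially"
      using filterlim_real_sequentially unfolding filterlim_at_top_dense by blast
    then show "eventually (\<lambda>n. F (x - real n) = 0) sequentially"
      by eventually_elim (auto intro!: r)
  qed
  have "(\<lambda>n. LINT x|R. F (x - real n)) \<longlonglongrightarrow> (LINT x|R. 0)"
    by (rule integral_dominated_convergence[where w = "\<lambda>_. B"])
       (auto intro!: lim B always_eventually)
  then show "(\<lambda>n. LINT x|R. F (x - real n)) \<longlonglongrightarrow> 0" by simp
  show "integrable R (\<lambda>x. F (x - c))"
    by (rule R.integrable_const_bound[where B = B]) (auto intro!: B always_eventually)
qed

text \<open>
  The \<open>m\<close>-th derivatives of test functions are orthogonal to all polynomials of degree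
  below \<open>m\<close>, but no polynomial except zero is the density of a finite signed measure.  Concretely, the
  identity for \<open>m + 1\<close> gives the identity for \<open>m\<close> up to an error consisting of integrals of a
  test function translated by \<open>T\<close>, and this error tends to zero as \<open>T\<close> grows.
\<close>

lemma funpow_deriv_integral_determines:
  assumes P: "real_distribution P" and Q: "real_distribution Q"
    and eq: "\<And>F. F \<in> Cc_infinity \<Longrightarrow> (LINT x|P. (deriv ^^ m) F x) = (LINT x|Q. (deriv ^^ m) F x)"
  shows "P = Q"
  using eq
proof (induction m)
  case 0
  then show ?case using Cc_infinity_integral_determines[OF P Q] by simp
next
  case (Suc m)
  show ?case
  proof (rule Suc.IH)
    fix F assume F: "F \<in> Cc_infinity"
    let ?f = "(deriv ^^ m) F"
    have f: "?f \<in> Cc_infinity" by (rule Cc_infinity_funpow_deriv[OF F])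
    have int: "(LINT x|R. ?f x - ?f (x - T)) = (LINT x|R. ?f x) - (LINT x|R. ?f (x - T))"
      if "real_distribution R" for R T
      using shift_integral_tendsto_0(2)[OF that f, of 0] shift_integral_tendsto_0(2)[OF that f, of T]
      by simp
    \<comment> \<open>The left side does not depend on \<open>n\<close>, while the right side tends to zero.  The successor is
      there because the window needs a positive length.\<close>
    have diff: "(LINT x|P. ?f x) - (LINT x|Q. ?f x) =
        (LINT x|P. ?f (x - real (Suc n))) - (LINT x|Q. ?f (x - real (Suc n)))" for n
    proof -
      obtain G where "G \<in> Cc_infinity"
        "\<And>n' x. (deriv ^^ Suc n') G x = (deriv ^^ n') F x - (deriv ^^ n') F (x - real (Suc n))"
        using Cc_infinity_shifted_difference[OF F, of "real (Suc n)"] by auto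
      with Suc.prems[of G] have "(LINT x|P. ?f x - ?f (x - real (Suc n))) =
          (LINT x|Q. ?f x - ?f (x - real (Suc n)))"
        by (simp only:)
      then show ?thesis
        unfolding int[OF P] int[OF Q] by linarith
    qed
    have "(\<lambda>n. (LINT x|P. ?f (x - real (Suc n))) - (LINT x|Q. ?f (x - real (Suc n)))) \<longlonglongrightarrow> 0 - 0"
      by (intro tendsto_diff LIMSEQ_Suc shift_integral_tendsto_0(1) P Q f)
    then show "(LINT x|P. ?f x) = (LINT x|Q. ?f x)"
      unfolding diff[symmetric] by (simp add: LIMSEQ_const_iff)
  qed
qed

section \<open>Functions of polynomial growth under the normal law\<close>

text \<open>
  A class of functions that contains both the polynomials and the test functions, so that a single
  integration by parts serves the transformation and its normalising constant.
\<close>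

definition poly_growth :: "(real \<Rightarrow> real) \<Rightarrow> bool" where
  "poly_growth f \<longleftrightarrow> (\<exists>p. \<forall>x. \<bar>f x\<bar> \<le> poly p x)"

lemma poly_growth_add:
  assumes "poly_growth f" "poly_growth g"
  shows "poly_growth (\<lambda>x. f x + g x)"
proof -
  from assms obtain p q where "\<And>x. \<bar>f x\<bar> \<le> poly p x" "\<And>x. \<bar>g x\<bar> \<le> poly q x"
    unfolding poly_growth_def by blast
  then have "\<bar>f x + g x\<bar> \<le> poly (p + q) x" for x
    by (simp add: order_trans[OF abs_triangle_ineq add_mono])
  then show ?thesis unfolding poly_growth_def by blast
qed

lemma poly_growth_mult:
  assumes "poly_growth f" "poly_growth g"
  shows "poly_growth (\<lambda>x. f x * g x)"
proof -
  from assms obtain p q where "\<And>x. \<bar>f x\<bar> \<le> poly p x" "\<And>x. \<bar>g x\<bar> \<le> poly q x"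
    unfolding poly_growth_def by blast
  then have "\<bar>f x * g x\<bar> \<le> poly (p * q) x" for x
    unfolding poly_mult abs_mult by (intro mult_mono) (auto intro: order_trans[OF abs_ge_zero])
  then show ?thesis unfolding poly_growth_def by blast
qed

lemma poly_growth_bounded: "(\<And>x. \<bar>f x\<bar> \<le> B) \<Longrightarrow> poly_growth f"
  unfolding poly_growth_def by (intro exI[of _ "[:B:]"]) simp

lemma poly_growth_ident: "poly_growth (\<lambda>x. x)"
proof -
  have "\<bar>x\<bar> \<le> poly [:1, 0, 1:] x" for x :: real
  proof -
    have "0 \<le> (\<bar>x\<bar> - 1)\<^sup>2" by simp
    then show ?thesis by (simp add: power2_diff power2_eq_square[symmetric])
  qed
  then show ?thesis unfolding poly_growth_def by blast
qed

lemma poly_growth_poly: "poly_growth (poly p)"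
proof (induction p)
  case (pCons a p)
  have "poly_growth (\<lambda>x. a + x * poly p x)"
    by (intro poly_growth_add poly_growth_mult poly_growth_ident pCons poly_growth_bounded[of _ "\<bar>a\<bar>"]) simp
  moreover have "poly (pCons a p) = (\<lambda>x. a + x * poly p x)" by auto
  ultimately show ?case by simp
qed (rule poly_growth_bounded[of _ 0], simp)

lemma borel_measurable_poly [measurable]: "poly p \<in> borel_measurable borel" for p :: "real poly"
  by (auto intro!: borel_measurable_continuous_onI continuous_intros)

lemma integrable_normal_density_times_poly:
  assumes "s > 0"
  shows "integrable lborel (\<lambda>x. normal_density 0 s x * poly p x)"
proof -
  have "integrable lborel (\<lambda>x. \<Sum>i\<le>degree p. coeff p i * (normal_density 0 s x * (x - 0) ^ i))"
    by (intro Bochner_Integration.integrable_sum integrable_mult_right integrable_normal_moment assms)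
  then show ?thesis
    by (simp add: poly_altdef sum_distrib_left mult.left_commute mult.commute mult.assoc)
qed

lemma integrable_normal_density_poly_growth:
  assumes "s > 0" "poly_growth f" and [measurable]: "f \<in> borel_measurable borel"
  shows "integrable lborel (\<lambda>x. normal_density 0 s x * f x)"
proof -
  obtain p where p: "\<And>x. \<bar>f x\<bar> \<le> poly p x" using assms(2) unfolding poly_growth_def by blast
  show ?thesis
  proof (rule Bochner_Integration.integrable_bound[OF integrable_normal_density_times_poly[OF assms(1), of p]])
    show "AE x in lborel. norm (normal_density 0 s x * f x) \<le> norm (normal_density 0 s x * poly p x)"
      by (auto simp: abs_mult intro!: mult_left_mono always_eventually order_trans[OF p])
  qed simp
qed

lemma integrable_normal_law:
  assumes "l > 0" "poly_growth f" and [measurable]: "f \<in> borel_measurable borel"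
  shows "integrable (normal_law l) f"
  unfolding normal_law_def
  using integrable_normal_density_poly_growth[OF _ assms(2,3), of "sqrt l"] assms(1)
  by (subst integrable_density) auto

lemma integral_normal_law:
  assumes "f \<in> borel_measurable borel"
  shows "(LINT x|normal_law l. f x) = (LINT x|lborel. normal_density 0 (sqrt l) x * f x)"
  unfolding normal_law_def using assms by (subst integral_density) auto

lemma real_distribution_normal_law: "l > 0 \<Longrightarrow> real_distribution (normal_law l)"
  unfolding normal_law_def real_distribution_def real_distribution_axioms_def
  by (simp add: prob_space_normal_density)

text \<open>
  Writing \<open>t = (1 + x\<^sup>2) / (2 * s\<^sup>2)\<close> turns the Gaussian factor into a constant multiple of
  \<open>exp (- t)\<close>, and \<open>\<bar>x\<bar> ^ k\<close> is at most \<open>(1 + x\<^sup>2) ^ k\<close>, a constant multiple of \<open>t ^ k\<close>.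
\<close>

lemma power_times_normal_density_tendsto_0:
  assumes "s > 0"
  shows "((\<lambda>x. normal_density 0 s x * x ^ k) \<longlongrightarrow> 0) at_infinity"
proof -
  define c where "c = 2 * s\<^sup>2"
  have c: "c > 0" using assms by (simp add: c_def)
  define K where "K = exp (1 / c) * c ^ k / sqrt (pi * c)"
  let ?t = "\<lambda>x::real. (1 + x\<^sup>2) / c"
  have "filterlim (\<lambda>x::real. norm x ^ 2) at_top at_infinity"
    by (intro filterlim_pow_at_top filterlim_norm_at_top) auto
  then have "filterlim (\<lambda>x::real. 1 + x\<^sup>2) at_top at_infinity"
    by (intro filterlim_tendsto_add_at_top[OF tendsto_const]) simp
  then have "filterlim ?t at_top at_infinity"
    unfolding divide_inverse using c
    by (intro filterlim_at_top_mult_tendsto_pos[OF tendsto_const]) simp_all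
  then have lim: "((\<lambda>x. K * (?t x ^ k / exp (?t x))) \<longlongrightarrow> K * 0) at_infinity"
    by (intro tendsto_mult tendsto_const filterlim_compose[OF tendsto_power_div_exp_0])
  have bound: "norm (normal_density 0 s x * x ^ k) \<le> K * (?t x ^ k / exp (?t x))" for x
  proof -
    have "\<bar>x\<bar> \<le> 1 + x\<^sup>2" using zero_le_power2[of "\<bar>x\<bar> - 1"] by (simp add: power2_diff)
    then have "\<bar>x\<bar> ^ k \<le> (1 + x\<^sup>2) ^ k" by (intro power_mono) auto
    then have "normal_density 0 s x * \<bar>x\<bar> ^ k \<le> normal_density 0 s x * (1 + x\<^sup>2) ^ k"
      by (intro mult_left_mono) auto
    also have "\<dots> = K * (?t x ^ k / exp (?t x))"
    proof -
      have "2 * pi * s\<^sup>2 = pi * c" by (simp add: c_def)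
      then have density: "normal_density 0 s x = inverse (exp (x\<^sup>2 / c)) / sqrt (pi * c)"
        unfolding normal_density_def c_def[symmetric] by (simp add: exp_minus[symmetric])
      have exp: "exp (?t x) = exp (1 / c) * exp (x\<^sup>2 / c)"
        by (simp add: add_divide_distrib exp_add)
      have cancel: "inverse b / r * q = (a * d / r) * (q / d / (a * b))"
        if "a \<noteq> 0" "d \<noteq> 0" for a b d q r :: real
        using that by (simp add: divide_simps)
      show ?thesis
        unfolding density exp K_def power_divide by (rule cancel) (use c in simp_all)
    qed
    finally show ?thesis by (simp add: abs_mult power_abs)
  qed
  show ?thesis
    by (rule Lim_null_comparison[OF always_eventually[OF allI[OF bound]] lim[unfolded mult_zero_right]])
qed

lemma normal_density_poly_growth_tendsto_0:
  assumes "s > 0" "poly_growth f"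
  shows "((\<lambda>x. normal_density 0 s x * f x) \<longlongrightarrow> 0) at_infinity"
proof -
  obtain p where p: "\<And>x. \<bar>f x\<bar> \<le> poly p x" using assms(2) unfolding poly_growth_def by blast
  have "((\<lambda>x. \<Sum>i\<le>degree p. coeff p i * (normal_density 0 s x * x ^ i)) \<longlongrightarrow>
      (\<Sum>i\<le>degree p. coeff p i * 0)) at_infinity"
    by (intro tendsto_intros power_times_normal_density_tendsto_0 assms)
  then have "((\<lambda>x. normal_density 0 s x * poly p x) \<longlongrightarrow> 0) at_infinity"
    by (simp add: poly_altdef sum_distrib_left mult.left_commute mult.commute mult.assoc)
  then show ?thesis
    by (rule Lim_null_comparison[OF always_eventually[OF allI], rotated])
       (simp add: abs_mult mult_left_mono p)
qed

section \<open>Gaussian integration by parts\<close>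

lemma integral_deriv_eq_0:
  fixes W W' :: "real \<Rightarrow> real"
  assumes "\<And>x. (W has_real_derivative W' x) (at x)" "\<And>x. isCont W' x"
    and "integrable lborel W'" and "(W \<longlongrightarrow> 0) at_infinity"
  shows "(LINT x|lborel. W' x) = 0"
proof -
  have "(LBINT x=-\<infinity>..\<infinity>. W' x) = 0 - 0"
  proof (rule interval_integral_FTC_integrable[where F = W])
    show "set_integrable lborel (einterval (- \<infinity>) \<infinity>) W'"
      using assms(3) by (simp add: set_integrable_def)
    show "((W \<circ> real_of_ereal) \<longlongrightarrow> 0) (at_right (- \<infinity>))" "((W \<circ> real_of_ereal) \<longlongrightarrow> 0) (at_left \<infinity>)"
      unfolding ereal_tendsto_simps
      using assms(4) tendsto_mono at_top_le_at_infinity at_bot_le_at_infinity by blast+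
  qed (use assms in \<open>auto simp: has_real_derivative_iff_has_vector_derivative\<close>)
  then show ?thesis
    by (simp add: interval_lebesgue_integral_def set_lebesgue_integral_def)
qed

text \<open>
  With \<open>\<phi>\<close> the density of the normal law, \<open>l * \<phi>'(x) = - x * \<phi>(x)\<close>, hence
  \<open>(l * \<phi> * G)' = \<phi> * (l * G' - x * G)\<close>, and this derivative integrates to zero.
\<close>

lemma stein_identity:
  assumes l: "l > 0"
    and G: "\<And>x. (G has_real_derivative G' x) (at x)" and cont: "\<And>x. isCont G' x"
    and growth: "poly_growth G" "poly_growth G'"
  shows "(LINT x|normal_law l. x * G x) = l * (LINT x|normal_law l. G' x)"
proof -
  let ?\<phi> = "normal_density 0 (sqrt l)"
  have [measurable]: "G \<in> borel_measurable borel" "G' \<in> borel_measurable borel"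
    using DERIV_isCont[OF G] cont
    by (auto intro!: borel_measurable_continuous_onI continuous_at_imp_continuous_on)
  have ints: "integrable lborel (\<lambda>x. ?\<phi> x * (l * G' x))" "integrable lborel (\<lambda>x. ?\<phi> x * (x * G x))"
    using l by (intro integrable_normal_density_poly_growth poly_growth_mult growth poly_growth_ident
        poly_growth_bounded[of "\<lambda>_. l" l]; simp)+
  have deriv: "((\<lambda>x. ?\<phi> x * (l * G x)) has_real_derivative ?\<phi> x * (l * G' x) - ?\<phi> x * (x * G x)) (at x)" for x
    unfolding normal_density_def
    by (rule derivative_eq_intros refl G | use l in \<open>force simp: field_simps\<close>)+
  have "(LINT x|lborel. ?\<phi> x * (l * G' x) - ?\<phi> x * (x * G x)) = 0"
  proof (rule integral_deriv_eq_0[OF deriv])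
    show "isCont (\<lambda>x. ?\<phi> x * (l * G' x) - ?\<phi> x * (x * G x)) x" for x
      unfolding normal_density_def using l
      by (intro continuous_intros cont DERIV_isCont[OF G]) auto
    show "((\<lambda>x. ?\<phi> x * (l * G x)) \<longlongrightarrow> 0) at_infinity"
      using l by (intro normal_density_poly_growth_tendsto_0 poly_growth_mult growth
          poly_growth_bounded[of "\<lambda>_. l" l]) simp_all
  qed (use ints in simp)
  then have "(LINT x|lborel. ?\<phi> x * (x * G x)) = (LINT x|lborel. ?\<phi> x * (l * G' x))"
    using ints by simp
  then show ?thesis by (simp add: integral_normal_law mult.left_commute)
qed

text \<open>
  The recursion \<open>H\<^sub>m\<^sub>+\<^sub>1 = x * H\<^sub>m - l * H\<^sub>m'\<close> is the form of the Hermite polynomials that fits Stein's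
  identity.
\<close>

primrec hermite_poly :: "real \<Rightarrow> nat \<Rightarrow> real poly" where
  "hermite_poly l 0 = 1"
| "hermite_poly l (Suc m) = [:0, 1:] * hermite_poly l m - smult l (pderiv (hermite_poly l m))"

lemma hermite_eq_poly:
  assumes "l > 0"
  shows "hermite l m x = poly (hermite_poly l m) x"
proof -
  \<comment> \<open>The \<open>n\<close>-th derivative of the Gaussian: each differentiation brings out one factor \<open>- 1 / l\<close>.\<close>
  define D where "D n y = (- (1 / l)) ^ n * (poly (hermite_poly l n) y * exp (- (y\<^sup>2 / (2 * l))))" for n y
  have "(D n has_real_derivative D (Suc n) y) (at y)" for n y
    unfolding D_def
    by (rule derivative_eq_intros refl | use assms in \<open>force simp: field_simps\<close>)+
  then have "(deriv ^^ m) (D 0) = D m" by (rule funpow_deriv_eqI)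
  moreover have "D 0 = (\<lambda>y. exp (- (y\<^sup>2 / (2 * l))))" by (simp add: D_def fun_eq_iff)
  ultimately have "hermite l m x = ((- l) * (- (1 / l))) ^ m * poly (hermite_poly l m) x *
      (exp (x\<^sup>2 / (2 * l)) * exp (- (x\<^sup>2 / (2 * l))))"
    unfolding hermite_def power_mult_distrib by (simp add: D_def mult_ac)
  also have "\<dots> = poly (hermite_poly l m) x"
    using assms by (simp add: exp_minus)
  finally show ?thesis .
qed

text \<open>
  Stein's identity for \<open>G = H\<^sub>m * D 0\<close> reads
  \<open>E[x * H\<^sub>m * D 0] = l * E[H\<^sub>m' * D 0] + l * E[H\<^sub>m * D 1]\<close>, that is,
  \<open>E[H\<^sub>m\<^sub>+\<^sub>1 * D 0] = l * E[H\<^sub>m * D 1]\<close>: one Hermite degree is traded for one derivative.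
\<close>

lemma hermite_integration_by_parts:
  fixes D :: "nat \<Rightarrow> real \<Rightarrow> real"
  assumes l: "l > 0"
    and "\<And>n x. (D n has_real_derivative D (Suc n) x) (at x)" "\<And>n. poly_growth (D n)"
  shows "(LINT x|normal_law l. poly (hermite_poly l m) x * D 0 x) = l ^ m * (LINT x|normal_law l. D m x)"
  using assms(2,3)
proof (induction m arbitrary: D)
  case (Suc m)
  let ?H = "hermite_poly l m"
  have cont: "isCont (D n) x" for n x using DERIV_isCont[OF Suc.prems(1)] .
  then have [measurable]: "D n \<in> borel_measurable borel" for n
    by (auto intro!: borel_measurable_continuous_onI continuous_at_imp_continuous_on)
  have int: "integrable (normal_law l) (\<lambda>x. poly p x * D n x)" for p n
    by (intro integrable_normal_law poly_growth_mult poly_growth_poly Suc.prems(2) l) simp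
  have "(LINT x|normal_law l. x * (poly ?H x * D 0 x)) =
      l * (LINT x|normal_law l. poly (pderiv ?H) x * D 0 x + poly ?H x * D 1 x)"
  proof (rule stein_identity[OF l])
    show "((\<lambda>x. poly ?H x * D 0 x) has_real_derivative
        poly (pderiv ?H) x * D 0 x + poly ?H x * D 1 x) (at x)" for x
      by (rule derivative_eq_intros refl Suc.prems(1) | simp add: algebra_simps)+
    show "isCont (\<lambda>x. poly (pderiv ?H) x * D 0 x + poly ?H x * D 1 x) x" for x
      by (intro continuous_intros cont)
  qed (intro poly_growth_add poly_growth_mult poly_growth_poly Suc.prems(2))+
  also have "\<dots> = l * (LINT x|normal_law l. poly (pderiv ?H) x * D 0 x) +
      l * (LINT x|normal_law l. poly ?H x * D 1 x)"
    using int by (simp add: distrib_left)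
  also have "(LINT x|normal_law l. poly ?H x * D 1 x) = l ^ m * (LINT x|normal_law l. D (Suc m) x)"
    using Suc.IH[of "\<lambda>n. D (Suc n)"] Suc.prems by simp
  finally have "(LINT x|normal_law l. poly ([:0, 1:] * ?H) x * D 0 x) -
      (LINT x|normal_law l. l * (poly (pderiv ?H) x * D 0 x)) = l ^ Suc m * (LINT x|normal_law l. D (Suc m) x)"
    by (simp add: algebra_simps)
  then show ?case
    using int[of "[:0, 1:] * ?H" 0] int[of "pderiv ?H" 0]
    by (subst (asm) Bochner_Integration.integral_diff[symmetric]) (simp_all add: algebra_simps)
qed simp

section \<open>The normal law as a fixed point\<close>

lemma Cc_infinity_poly_growth: "F \<in> Cc_infinity \<Longrightarrow> poly_growth F"
  by (erule Cc_infinity_bounded) (rule poly_growth_bounded)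

lemma hermite_integral_Cc_infinity:
  assumes "l > 0" "F \<in> Cc_infinity"
  shows "integrable (normal_law l) (\<lambda>x. hermite l m x * F x)"
    and "integrable (normal_law l) ((deriv ^^ m) F)"
    and "(LINT x|normal_law l. hermite l m x * F x) = l ^ m * (LINT x|normal_law l. (deriv ^^ m) F x)"
proof -
  have sm: "smooth F" using assms(2) unfolding Cc_infinity_iff by (rule conjunct1)
  have growth: "poly_growth ((deriv ^^ n) F)" for n
    by (intro Cc_infinity_poly_growth Cc_infinity_funpow_deriv assms)
  have [measurable]: "(deriv ^^ n) F \<in> borel_measurable borel" for n
    by (intro borel_measurable_smooth smooth_funpow_deriv sm)
  have [measurable]: "F \<in> borel_measurable borel"
    by (rule borel_measurable_smooth[OF sm])
  show "integrable (normal_law l) (\<lambda>x. hermite l m x * F x)"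
    unfolding hermite_eq_poly[OF assms(1)]
    using growth[of 0] by (intro integrable_normal_law poly_growth_mult poly_growth_poly assms) simp_all
  show "integrable (normal_law l) ((deriv ^^ m) F)"
    by (intro integrable_normal_law growth assms) simp
  show "(LINT x|normal_law l. hermite l m x * F x) = l ^ m * (LINT x|normal_law l. (deriv ^^ m) F x)"
    unfolding hermite_eq_poly[OF assms(1)]
    using hermite_integration_by_parts[of l "\<lambda>n. (deriv ^^ n) F" m, OF assms(1) smooth_has_deriv[OF sm] growth]
    by simp
qed

lemma funpow_pderiv_monom_degree:
  fixes c :: real
  shows "(pderiv ^^ m) (monom c m) = [:fact m * c:]"
proof (induction m arbitrary: c)
  case (Suc m)
  have "(pderiv ^^ Suc m) (monom c (Suc m)) = (pderiv ^^ m) (monom (real (Suc m) * c) m)"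
    unfolding funpow_Suc_right comp_def by (simp add: pderiv_monom)
  also have "\<dots> = [:fact (Suc m) * c:]" unfolding Suc by simp
  finally show ?case .
qed (simp add: monom_0)

text \<open>
  The same integration by parts with the monomial \<open>x ^ m\<close>, whose \<open>m\<close>-th derivative is \<open>fact m\<close>.
\<close>

lemma hermite_alpha_normal_law:
  assumes "l > 0"
  shows "hermite_alpha l m (normal_law l) = l ^ m"
proof -
  interpret real_distribution "normal_law l" by (rule real_distribution_normal_law[OF assms])
  let ?D = "\<lambda>n. poly ((pderiv ^^ n) (monom (1::real) m))"
  have "(?D n has_real_derivative ?D (Suc n) x) (at x)" for n x
    by (simp add: poly_DERIV)
  then have "(LINT x|normal_law l. poly (hermite_poly l m) x * ?D 0 x) = l ^ m * (LINT x|normal_law l. ?D m x)"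
    by (rule hermite_integration_by_parts[OF assms]) (rule poly_growth_poly)
  moreover have "?D 0 = (\<lambda>x. x ^ m)" by (auto simp: poly_monom)
  moreover have "?D m = (\<lambda>x. fact m)"
    by (simp add: funpow_pderiv_monom_degree fun_eq_iff)
  ultimately show ?thesis
    unfolding hermite_alpha_def hermite_eq_poly[OF assms] using prob_space by (simp add: mult.commute)
qed

lemma is_hermite_biased_normal_law_iff:
  assumes "l > 0"
  shows "is_hermite_biased l m (normal_law l) Q \<longleftrightarrow> Q = normal_law l"
proof
  assume Q: "is_hermite_biased l m (normal_law l) Q"
  then have "l ^ m * (LINT x|Q. (deriv ^^ m) F x) = l ^ m * (LINT x|normal_law l. (deriv ^^ m) F x)"
    if "F \<in> Cc_infinity" for F
    using that hermite_integral_Cc_infinity(3)[OF assms that, of m]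
    by (simp add: is_hermite_biased_def hermite_alpha_normal_law[OF assms])
  then show "Q = normal_law l"
    using Q assms
    by (intro funpow_deriv_integral_determines[of _ _ m]) (auto simp: is_hermite_biased_def)
next
  assume Q: "Q = normal_law l"
  have "integrable (normal_law l) (\<lambda>x. x ^ k)" for k
  proof -
    have "poly (monom 1 k) = (\<lambda>x::real. x ^ k)" by (auto simp: poly_monom)
    then show ?thesis
      using integrable_normal_law[OF assms poly_growth_poly borel_measurable_poly, of "monom 1 k"]
      by simp
  qed
  then show "is_hermite_biased l m (normal_law l) Q"
    unfolding Q is_hermite_biased_def normal_moments_upto_def hermite_alpha_normal_law[OF assms]
    using hermite_integral_Cc_infinity(3)[OF assms] real_distribution_normal_law[OF assms] by auto
qed

theorem mainTheorem6:
  fixes l :: real and m :: nat and M :: "'a measure" and Z :: "'a \<Rightarrow> real"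
  assumes "l > 0"
    and "prob_space M"
    and "distributed M lborel Z (normal_density 0 (sqrt l))"
  shows "(\<forall>F\<in>Cc_infinity.
            integrable M (\<lambda>\<omega>. hermite l m (Z \<omega>) * F (Z \<omega>)) \<and>
            integrable M (\<lambda>\<omega>. (deriv ^^ m) F (Z \<omega>)) \<and>
            prob_space.expectation M (\<lambda>\<omega>. hermite l m (Z \<omega>) * F (Z \<omega>)) =
              l ^ m * prob_space.expectation M (\<lambda>\<omega>. (deriv ^^ m) F (Z \<omega>))) \<and>
         (\<forall>Q. is_hermite_biased l m (distr M borel Z) Q \<longleftrightarrow> Q = distr M borel Z) \<and>
         hermite_transform l m (distr M borel Z) = distr M borel Z \<and>
         hermite_transform l m (normal_law l) = normal_law l"
proof -
  have law: "distr M borel Z = normal_law l"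
    using assms(3) distr_cong[of M M lborel borel Z Z] by (simp add: distributed_def normal_law_def)
  have Z: "Z \<in> measurable M borel"
    using distributed_measurable[OF assms(3)] by simp
  have transfer: "integrable M (\<lambda>\<omega>. f (Z \<omega>))"
      "(LINT \<omega>|M. f (Z \<omega>)) = (LINT x|normal_law l. f x)" if "integrable (normal_law l) f" for f :: "real \<Rightarrow> real"
    using that borel_measurable_integrable[OF that] unfolding law[symmetric]
    by (simp_all add: integrable_distr_eq[OF Z] integral_distr[OF Z])
  have "hermite_transform l m (normal_law l) = normal_law l"
    unfolding hermite_transform_def is_hermite_biased_normal_law_iff[OF assms(1)] by simp
  then show ?thesis
    unfolding law is_hermite_biased_normal_law_iff[OF assms(1)]
    using transfer(1)[OF hermite_integral_Cc_infinity(1)[OF assms(1)]]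
      transfer(1)[OF hermite_integral_Cc_infinity(2)[OF assms(1)]]
      transfer(2)[OF hermite_integral_Cc_infinity(1)[OF assms(1)]]
      transfer(2)[OF hermite_integral_Cc_infinity(2)[OF assms(1)]]
      hermite_integral_Cc_infinity(3)[OF assms(1)]
    by simp
qed

end
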